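(* Let $1\le m\le n-1$ and let $X_1,\dots,X_n$ be independent Bernoulli trials with success probabilities $p_k=P(X_k=1)$. For the problem of selecting the $m$th last success, consider the threshold policy $\tau^*$ which stops on the first success, if any, on or after the index $$k'(n) := \max\Big\{ i\in\{1,\dots,n-m\} : \sum_{k=i}^n p_k \ge m\Big\}\vee 1,\qquad \max\varnothing=-\infty .$$ If $$p_{k'(n)}\ge p_{k'(n)+1}\quad\text{and}\quad p_{k'(n)+1}=\max_{k'(n)+1\le j\le n}p_j ,$$ then $\tau^*$ is $\varepsilon$-optimal for some $\varepsilon$ with $$0\le \varepsilon\le p_{k'(n)}\,p_{k'(n)+1}.$$ Moreover, when the success probabilities are given by the Karamata–Stirling profile $p_k=\theta/(\theta+k-1)$, $k\ge 1$, with $\theta>0$ (and $m,\theta$ fixed), one can choose $\varepsilon=\varepsilon_n=O(1/n^2)$ as $n\to\infty$, and the threshold rule is asymptotically optimal.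
   Context: Selection problem: $X_1,\dots,X_n$ are independent Bernoulli trials with known success probabilities $p_k=P(X_k=1)$, where $0<p_k<1$ is a standing assumption (in the Karamata–Stirling profile $p_1=1$ is allowed). Let $\mathcal F_k=\sigma(X_1,\dots,X_k)$. Let $\mathcal T$ be the class of stopping rules $\tau$ with $\{\tau=k\}\in\mathcal F_k$ for each $k$ and $X_\tau=1$ whenever the rule stops; rules may also never stop. A rule wins if it stops and $\sum_{j=\tau}^n X_j=m$, i.e. if it stops exactly on the $m$th last success. The optimal winning probability is $s_m^*(n)=\sup_{\tau\in\mathcal T}P\big(\sum_{j=\tau}^nX_j=m\big)$, where never stopping counts as not winning. The policy that stops on the first success on or after index $k$ wins with probability $s_m(k,n)=P(X_k+\cdots+X_n=m)$. A policy is $\varepsilon$-optimal if its winning probability is at least $s_m^*(n)-\varepsilon$. A sequence of policies, one for each $n$, is asymptotically optimal if the difference between $s_m^*(n)$ and its winning probability tends to $0$ as $n\to\infty$. Notation: $a\vee b=\max(a,b)$. *)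

theory Defs
  imports "HOL-Probability.Probability"
begin

definition bernoulli_trials ::
  "'a measure \<Rightarrow> nat \<Rightarrow> (nat \<Rightarrow> 'a \<Rightarrow> nat) \<Rightarrow> (nat \<Rightarrow> real) \<Rightarrow> bool" where
  "bernoulli_trials M n X p \<longleftrightarrow>
     prob_space M \<and>
     prob_space.indep_vars M (\<lambda>_. count_space UNIV) X {1..n} \<and>
     (\<forall>k\<in>{1..n}. (\<forall>\<omega>\<in>space M. X k \<omega> \<in> {0, 1}) \<and>
                 measure M {\<omega> \<in> space M. X k \<omega> = 1} = p k)"

text \<open>The sigma-algebra generated by \<open>X 1, \<dots>, X k\<close>, as a set of events.\<close>
definition history :: "'a measure \<Rightarrow> (nat \<Rightarrow> 'a \<Rightarrow> nat) \<Rightarrow> nat \<Rightarrow> 'a set set" where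
  "history M X k =
     sigma_sets (space M) {X i -` B \<inter> space M | i B. i \<in> {1..k}}"

text \<open>The value \<open>\<infinity>\<close> means that the rule never stops.\<close>
definition stopping_rules ::
  "'a measure \<Rightarrow> nat \<Rightarrow> (nat \<Rightarrow> 'a \<Rightarrow> nat) \<Rightarrow> ('a \<Rightarrow> enat) set" where
  "stopping_rules M n X =
     {\<tau>. (\<forall>\<omega>\<in>space M. \<tau> \<omega> \<in> insert \<infinity> (enat ` {1..n})) \<and>
         (\<forall>k\<in>{1..n}. {\<omega> \<in> space M. \<tau> \<omega> = enat k} \<in> history M X k) \<and>
         (\<forall>\<omega>\<in>space M. \<forall>k. \<tau> \<omega> = enat k \<longrightarrow> X k \<omega> = 1)}"

definition win_prob ::
  "'a measure \<Rightarrow> nat \<Rightarrow> (nat \<Rightarrow> 'a \<Rightarrow> nat) \<Rightarrow> nat \<Rightarrow> ('a \<Rightarrow> enat) \<Rightarrow> real" where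
  "win_prob M n X m \<tau> =
     measure M {\<omega> \<in> space M. \<exists>t. \<tau> \<omega> = enat t \<and> (\<Sum>j=t..n. X j \<omega>) = m}"

definition optimal_win_prob ::
  "'a measure \<Rightarrow> nat \<Rightarrow> (nat \<Rightarrow> 'a \<Rightarrow> nat) \<Rightarrow> nat \<Rightarrow> real" where
  "optimal_win_prob M n X m = (SUP \<tau>\<in>stopping_rules M n X. win_prob M n X m \<tau>)"

definition eps_optimal ::
  "'a measure \<Rightarrow> nat \<Rightarrow> (nat \<Rightarrow> 'a \<Rightarrow> nat) \<Rightarrow> nat \<Rightarrow> real \<Rightarrow> ('a \<Rightarrow> enat) \<Rightarrow> bool" where
  "eps_optimal M n X m \<epsilon> \<tau> \<longleftrightarrow>
     \<tau> \<in> stopping_rules M n X \<and> win_prob M n X m \<tau> \<ge> optimal_win_prob M n X m - \<epsilon>"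

text \<open>The problem with \<open>n\<close> trials lives on its own probability space \<open>M n\<close>, with
  trials \<open>X n 1, \<dots>, X n n\<close>; a single infinite sequence of trials is the special case
  where \<open>M\<close> and \<open>X\<close> do not depend on \<open>n\<close>.\<close>
definition asymptotically_optimal ::
  "(nat \<Rightarrow> 'a measure) \<Rightarrow> (nat \<Rightarrow> nat \<Rightarrow> 'a \<Rightarrow> nat) \<Rightarrow> nat \<Rightarrow> (nat \<Rightarrow> 'a \<Rightarrow> enat) \<Rightarrow> bool" where
  "asymptotically_optimal M X m \<tau> \<longleftrightarrow>
     (\<forall>n. \<tau> n \<in> stopping_rules (M n) n (X n)) \<and>
     (\<lambda>n. optimal_win_prob (M n) n (X n) m - win_prob (M n) n (X n) m (\<tau> n)) \<longlonglongrightarrow> 0"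

definition first_success_from ::
  "nat \<Rightarrow> (nat \<Rightarrow> 'a \<Rightarrow> nat) \<Rightarrow> nat \<Rightarrow> 'a \<Rightarrow> enat" where
  "first_success_from n X k \<omega> =
     (if \<exists>j\<in>{k..n}. X j \<omega> = 1 then enat (LEAST j. j \<in> {k..n} \<and> X j \<omega> = 1) else \<infinity>)"

text \<open>Inserting \<open>1\<close> renders the maximum with \<open>1\<close>, together with the convention that the
  maximum of the empty set is \<open>-\<infinity>\<close>.\<close>
definition threshold_index :: "(nat \<Rightarrow> real) \<Rightarrow> nat \<Rightarrow> nat \<Rightarrow> nat" where
  "threshold_index p m n =
     Max (insert 1 {i \<in> {1..n - m}. (\<Sum>k=i..n. p k) \<ge> real m})"

definition threshold_rule ::
  "(nat \<Rightarrow> real) \<Rightarrow> nat \<Rightarrow> nat \<Rightarrow> (nat \<Rightarrow> 'a \<Rightarrow> nat) \<Rightarrow> 'a \<Rightarrow> enat" where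
  "threshold_rule p m n X = first_success_from n X (threshold_index p m n)"

definition karamata_stirling :: "real \<Rightarrow> nat \<Rightarrow> real" where
  "karamata_stirling \<theta> k = \<theta> / (\<theta> + real k - 1)"

end

theory Submission
  imports Defs "HOL-Computational_Algebra.Polynomial" "HOL-Real_Asymp.Real_Asymp"
begin

text \<open>
  Let \<open>f j i = P(X\<^sub>j + \<dots> + X\<^sub>n = i)\<close>. Stopping on a success at index \<open>j\<close> wins with
  probability \<open>f (j+1) (m-1)\<close>, waiting for the next success wins with probability \<open>f (j+1) m\<close>.
  If the mean of \<open>S = X\<^sub>j + \<dots> + X\<^sub>n\<close> plus the largest success probability is at most \<open>m\<close>,
  then \<open>f j m \<le> f j (m-1)\<close>: this follows from the size-bias identity
  \<open>m P(S = m) = \<Sum>\<^sub>i p\<^sub>i P(S - X\<^sub>i = m-1)\<close> and unimodality. Exchanging successes and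
  failures, \<open>f j (m-1) \<le> f j m\<close> if the mean is at least \<open>m\<close> (part of Darroch's rule).
  Writing \<open>k\<close> for the threshold index, waiting is therefore right before \<open>k\<close> and
  stopping is right after \<open>k + 1\<close>, so the optimal value is at most
  \<open>max (f k m) (f (k+1) m)\<close>. Conditioning on \<open>X\<^sub>k\<close> and \<open>X\<^sub>k\<^sub>+\<^sub>1\<close> gives
  \<open>f (k+1) m - f k m \<le> p\<^sub>k p\<^sub>k\<^sub>+\<^sub>1\<close>. In the Karamata--Stirling case the tail sums
  dominate \<open>\<theta> ln ((\<theta> + n) / (\<theta> + i))\<close>, hence \<open>k\<close> grows linearly in \<open>n\<close>.
\<close>

section \<open>The Poisson binomial distribution\<close>

text \<open>The index is an integer so that \<open>i - 1\<close> is never truncated.\<close>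
definition poisson_binomial :: "('b \<Rightarrow> real) \<Rightarrow> 'b set \<Rightarrow> int \<Rightarrow> real" where
  "poisson_binomial p A i = (if i < 0 then 0 else coeff (\<Prod>j\<in>A. [:1 - p j, p j:]) (nat i))"

lemma poisson_binomial_empty [simp]: "poisson_binomial p {} i = (if i = 0 then 1 else 0)"
  by (auto simp: poisson_binomial_def)

text \<open>Read off from multiplying the generating polynomial by the linear factor of
  \<open>x\<close>. Nonpositive \<open>i\<close> is treated apart because \<open>nat\<close>
  truncates.\<close>

lemma poisson_binomial_insert:
  assumes "finite A" "x \<notin> A"
  shows "poisson_binomial p (insert x A) i = p x * poisson_binomial p A (i - 1) + (1 - p x) * poisson_binomial p A i"
proof (cases "i \<le> 0")
  case True
  then show ?thesis using assms by (cases "i = 0") (auto simp: poisson_binomial_def)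
next
  case False
  then obtain k where "i = int (Suc k)"
    by (metis not_le zero_less_imp_eq_int gr0_implies_Suc)
  then show ?thesis using assms by (simp add: poisson_binomial_def nat_add_distrib)
qed

lemma poisson_binomial_remove:
  assumes "finite A" "x \<in> A"
  shows "poisson_binomial p A i = p x * poisson_binomial p (A - {x}) (i - 1) + (1 - p x) * poisson_binomial p (A - {x}) i"
  using poisson_binomial_insert[of "A - {x}" x p i] assms by (simp add: insert_absorb)

lemma poisson_binomial_bounds:
  assumes "finite A" "\<And>j. j \<in> A \<Longrightarrow> 0 \<le> p j \<and> p j \<le> 1"
  shows "0 \<le> poisson_binomial p A i \<and> poisson_binomial p A i \<le> 1"
  using assms
proof (induction A arbitrary: i)
  case (insert x A)
  have x: "0 \<le> p x" "p x \<le> 1" using insert.prems by auto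
  have IH: "0 \<le> poisson_binomial p A i" "poisson_binomial p A i \<le> 1" for i using insert by auto
  have "p x * poisson_binomial p A (i - 1) + (1 - p x) * poisson_binomial p A i \<le> 1"
    using x IH by (intro convex_bound_le) auto
  then show ?case using insert.hyps x IH by (simp add: poisson_binomial_insert)
qed auto

text \<open>The form with two indices \<open>a \<le> b\<close>, stronger than the case
  \<open>a = b\<close>, also excludes internal zeros and makes the mixed term of the induction step
  nonnegative.\<close>

lemma poisson_binomial_log_concave:
  assumes "finite A" "\<And>j. j \<in> A \<Longrightarrow> 0 \<le> p j \<and> p j \<le> 1" "a \<le> b"
  shows "poisson_binomial p A (a - 1) * poisson_binomial p A (b + 1) \<le> poisson_binomial p A a * poisson_binomial p A b"
  using assms
proof (induction A arbitrary: a b)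
  case (insert x A)
  define f where "f = poisson_binomial p A"
  define P where "P = p x"
  have P: "0 \<le> P" "0 \<le> 1 - P" using insert.prems by (auto simp: P_def)
  have IH: "f (a - 1) * f (b + 1) \<le> f a * f b" if "a \<le> b" for a b
    using insert.IH[of a b] insert.prems that by (auto simp: f_def)
  have 1: "f (a - 1) * f (b + 1) \<le> f a * f b"
    using IH insert.prems by blast
  have 2: "f (a - 2) * f b \<le> f (a - 1) * f (b - 1)"
    using IH[of "a - 1" "b - 1"] insert.prems by simp
  have 3: "f (a - 2) * f (b + 1) \<le> f a * f (b - 1)"
  proof (cases "a = b")
    case True
    then show ?thesis using IH[of "a - 1" a] by (simp add: mult.commute)
  next
    case False
    then show ?thesis using IH[of "a - 1" b] IH[of a "b - 1"] insert.prems by simp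
  qed
  have "poisson_binomial p (insert x A) a * poisson_binomial p (insert x A) b - poisson_binomial p (insert x A) (a - 1) * poisson_binomial p (insert x A) (b + 1)
    = (1 - P)\<^sup>2 * (f a * f b - f (a - 1) * f (b + 1)) + P\<^sup>2 * (f (a - 1) * f (b - 1) - f (a - 2) * f b)
      + P * (1 - P) * (f a * f (b - 1) - f (a - 2) * f (b + 1))"
    using insert.hyps by (simp add: poisson_binomial_insert f_def P_def algebra_simps power2_eq_square)
  also have "\<dots> \<ge> 0" using 1 2 3 P by (intro add_nonneg_nonneg mult_nonneg_nonneg) auto
  finally show ?case by simp
qed auto

text \<open>A strict drop followed by a strict rise would make the square of the value at
  \<open>i\<close> smaller than the product of its neighbours, against log-concavity.\<close>

lemma poisson_binomial_unimodal:
  assumes "finite A" "\<And>j. j \<in> A \<Longrightarrow> 0 \<le> p j \<and> p j \<le> 1" "poisson_binomial p A i < poisson_binomial p A (i - 1)"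
  shows "poisson_binomial p A (i + 1) \<le> poisson_binomial p A i"
proof (rule ccontr)
  assume "\<not> ?thesis"
  moreover have "0 \<le> poisson_binomial p A i" using poisson_binomial_bounds[of A p i] assms by blast
  ultimately have "poisson_binomial p A i * poisson_binomial p A i < poisson_binomial p A (i - 1) * poisson_binomial p A (i + 1)"
    using assms(3) by (intro mult_strict_mono') auto
  then show False using poisson_binomial_log_concave[of A p i i] assms by force
qed

text \<open>Coefficient form of the product rule for \<open>z\<close> times the derivative of the
  generating polynomial in \<open>z\<close>.\<close>

lemma poisson_binomial_size_bias:
  assumes "finite A"
  shows "of_int i * poisson_binomial p A i = (\<Sum>j\<in>A. p j * poisson_binomial p (A - {j}) (i - 1))"
  using assms
proof (induction A arbitrary: i)
  case (insert x A)
  have "(\<Sum>j\<in>A. p j * poisson_binomial p (insert x A - {j}) (i - 1))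
      = (\<Sum>j\<in>A. p x * (p j * poisson_binomial p (A - {j}) (i - 1 - 1)) + (1 - p x) * (p j * poisson_binomial p (A - {j}) (i - 1)))"
  proof (rule sum.cong)
    fix j assume "j \<in> A"
    then have "insert x A - {j} = insert x (A - {j})" using insert.hyps by auto
    then show "p j * poisson_binomial p (insert x A - {j}) (i - 1)
      = p x * (p j * poisson_binomial p (A - {j}) (i - 1 - 1)) + (1 - p x) * (p j * poisson_binomial p (A - {j}) (i - 1))"
      using insert.hyps by (simp add: poisson_binomial_insert algebra_simps)
  qed simp
  also have "\<dots> = p x * (of_int (i - 1) * poisson_binomial p A (i - 1)) + (1 - p x) * (of_int i * poisson_binomial p A i)"
    by (simp only: sum.distrib sum_distrib_left[symmetric] insert.IH)
  \<comment> \<open>The remaining summand \<open>j = x\<close> is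
    \<open>p x * poisson_binomial p A (i - 1)\<close>; it lifts the factor \<open>i - 1\<close> to
    \<open>i\<close>.\<close>
  finally show ?case using insert.hyps by (simp add: poisson_binomial_insert algebra_simps)
qed auto

text \<open>Counts failures instead of successes, which later turns the descent criterion into an
  ascent criterion.\<close>

lemma poisson_binomial_complement:
  assumes "finite A"
  shows "poisson_binomial (\<lambda>j. 1 - p j) A i = poisson_binomial p A (int (card A) - i)"
  using assms
proof (induction A arbitrary: i)
  case (insert x A)
  have c: "int (card (insert x A)) - i = int (card A) - (i - 1)"
    "int (card A) - i = int (card A) - (i - 1) - 1" using insert.hyps by auto
  show ?case unfolding poisson_binomial_insert[OF insert.hyps] insert.IH c by simp
qed auto

section \<open>Position of the mode relative to the mean\<close>

lemma poisson_binomial_descent: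
  assumes A: "finite A" and p: "\<And>j. j \<in> A \<Longrightarrow> 0 \<le> p j \<and> p j \<le> P"
    and P: "0 \<le> P" "P < 1" and m: "1 \<le> m" and mean: "sum p A + P \<le> of_int m"
  shows "poisson_binomial p A m \<le> poisson_binomial p A (m - 1)"
proof -
  have p1: "\<And>j. j \<in> A \<Longrightarrow> 0 \<le> p j \<and> p j \<le> 1" using p P by force
  show ?thesis
  proof (rule ccontr)
    assume "\<not> ?thesis"
    then have less: "poisson_binomial p A (m - 1) < poisson_binomial p A m" by simp
    define d where "d j = poisson_binomial p (A - {j}) (m - 1) - poisson_binomial p (A - {j}) (m - 2)" for j
    \<comment> \<open>A drop of the law without trial \<open>j\<close> at \<open>m - 1\<close> would
      persist at \<open>m\<close> by unimodality, and mixing over trial \<open>j\<close> would carry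
      it over to \<open>A\<close>.\<close>
    have d: "0 \<le> d j" if j: "j \<in> A" for j
    proof (rule ccontr)
      assume "\<not> 0 \<le> d j"
      then have 1: "poisson_binomial p (A - {j}) (m - 1) < poisson_binomial p (A - {j}) (m - 2)" by (simp add: d_def)
      moreover have "poisson_binomial p (A - {j}) m \<le> poisson_binomial p (A - {j}) (m - 1)"
        using poisson_binomial_unimodal[of "A - {j}" p "m - 1"] 1 A p1 by auto
      ultimately have "poisson_binomial p A m \<le> poisson_binomial p A (m - 1)"
        using j p1[OF j] by (simp add: poisson_binomial_remove[OF A j] add_mono mult_left_mono)
      with less show False by simp
    qed
    have "(1 - P) * of_int m * poisson_binomial p A m \<le> (1 - P) * of_int m * poisson_binomial p A (m - 1)"
    proof -
      have step: "poisson_binomial p (A - {j}) (m - 1) = poisson_binomial p A (m - 1) + p j * d j" if "j \<in> A" for j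
        by (simp add: poisson_binomial_remove[OF A that, of p "m - 1"] d_def algebra_simps)
      have "of_int m * poisson_binomial p A m = (\<Sum>j\<in>A. p j * poisson_binomial p A (m - 1) + p j * (p j * d j))"
        unfolding poisson_binomial_size_bias[OF A] by (intro sum.cong) (auto simp: step algebra_simps)
      also have "\<dots> \<le> (\<Sum>j\<in>A. p j * poisson_binomial p A (m - 1) + P * (p j * d j))"
        using p d by (intro sum_mono add_left_mono mult_left_mono mult_right_mono mult_nonneg_nonneg)
          (auto simp: mult.left_commute[of P] intro!: mult_left_mono mult_right_mono)
      also have "\<dots> = sum p A * poisson_binomial p A (m - 1) + P * (\<Sum>j\<in>A. p j * d j)"
        by (simp add: sum.distrib sum_distrib_left sum_distrib_right)
      \<comment> \<open>Size bias at both \<open>m\<close> and \<open>m - 1\<close>. Feeding it back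
        produces \<open>P\<close> times the left-hand side, hence the factor
        \<open>1 - P\<close>.\<close>
      also have "(\<Sum>j\<in>A. p j * d j) = of_int m * poisson_binomial p A m - of_int (m - 1) * poisson_binomial p A (m - 1)"
        unfolding poisson_binomial_size_bias[OF A] d_def by (simp add: sum_subtractf right_diff_distrib)
      \<comment> \<open>The coefficient of \<open>poisson_binomial p A (m - 1)\<close> becomes
        \<open>m - P - P * (m - 1) = (1 - P) * m\<close>, matching the left-hand side.\<close>
      also have "sum p A * poisson_binomial p A (m - 1) \<le> (of_int m - P) * poisson_binomial p A (m - 1)"
        using mean poisson_binomial_bounds[OF A p1] by (intro mult_right_mono) auto
      finally show ?thesis by (simp add: algebra_simps)
    qed
    with less P m show False by (simp add: mult_le_cancel_left)
  qed
qed

text \<open>Descent of the number of failures at \<open>card A - m + 1\<close>: its mean is at most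
  \<open>card A - m\<close>, which leaves room for one failure probability.\<close>

lemma poisson_binomial_ascent:
  assumes A: "finite A" and p: "\<And>j. j \<in> A \<Longrightarrow> 0 < p j \<and> p j \<le> 1"
    and mean: "of_int m \<le> sum p A"
  shows "poisson_binomial p A (m - 1) \<le> poisson_binomial p A m"
proof -
  \<comment> \<open>The largest failure probability, below 1 because every \<open>p j\<close> is
    positive; the inserted \<open>0\<close> covers empty \<open>A\<close>.\<close>
  define P where "P = Max (insert 0 ((\<lambda>j. 1 - p j) ` A))"
  have fin: "finite (insert 0 ((\<lambda>j. 1 - p j) ` A))" using A by simp
  have P: "0 \<le> P" "P < 1" using fin p by (auto simp: P_def)
  have q: "1 - p j \<le> P" if "j \<in> A" for j using fin that by (auto simp: P_def)
  have "sum p A \<le> of_nat (card A)" using p sum_bounded_above[of A p 1] by auto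
  then have "1 \<le> int (card A) - m + 1" using mean by linarith
  then have "poisson_binomial (\<lambda>j. 1 - p j) A (int (card A) - m + 1) \<le> poisson_binomial (\<lambda>j. 1 - p j) A (int (card A) - m + 1 - 1)"
    using A P p q mean by (intro poisson_binomial_descent[where P = P]) (auto simp: sum_subtractf)
  then show ?thesis by (simp add: poisson_binomial_complement[OF A])
qed

section \<open>Stopping rules for Bernoulli trials\<close>

lemma measurable_sum_nat:
  fixes Y :: "'i \<Rightarrow> 'a \<Rightarrow> nat"
  assumes "finite A" "\<And>j. j \<in> A \<Longrightarrow> Y j \<in> measurable N (count_space UNIV)"
  shows "(\<lambda>\<omega>. \<Sum>j\<in>A. Y j \<omega>) \<in> measurable N (count_space UNIV)"
  using assms
proof (induction A)
  case (insert x A)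
  have [measurable]: "Y x \<in> measurable N (count_space UNIV)"
    "(\<lambda>\<omega>. \<Sum>j\<in>A. Y j \<omega>) \<in> measurable N (count_space UNIV)"
    using insert by auto
  show ?case using insert.hyps by simp
qed simp

lemma sigma_algebra_history:
  "sigma_algebra (space M) (history M X k)"
  unfolding history_def by (intro sigma_algebra_sigma_sets) auto

lemma history_mono: "k \<le> l \<Longrightarrow> history M X k \<subseteq> history M X l"
  unfolding history_def by (intro sigma_sets_mono') force

lemma history_vimage: "i \<in> {1..k} \<Longrightarrow> X i -` B \<inter> space M \<in> history M X k"
  unfolding history_def by (intro sigma_sets.Basic) auto

section \<open>Law and independence of the trials\<close>

context
  fixes M :: "'a measure" and n X p
  assumes bern: "bernoulli_trials M n X p"
begin

interpretation prob_space M using bern by (simp add: bernoulli_trials_def)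

lemma trials_measurable: "j \<in> {1..n} \<Longrightarrow> X j \<in> measurable M (count_space UNIV)"
  using bern by (auto simp: bernoulli_trials_def indep_vars_def)

lemma trials_values: "j \<in> {1..n} \<Longrightarrow> \<omega> \<in> space M \<Longrightarrow> X j \<omega> = 0 \<or> X j \<omega> = 1"
  using bern by (auto simp: bernoulli_trials_def)

lemma trials_prob: "j \<in> {1..n} \<Longrightarrow> prob {\<omega> \<in> space M. X j \<omega> = 1} = p j"
  using bern by (auto simp: bernoulli_trials_def)

lemma prob_bounds: "j \<in> {1..n} \<Longrightarrow> 0 \<le> p j \<and> p j \<le> 1"
  using trials_prob[of j] by (metis measure_nonneg prob_le_1)

lemma trials_sum_measurable:
  "A \<subseteq> {1..n} \<Longrightarrow> (\<lambda>\<omega>. \<Sum>j\<in>A. X j \<omega>) \<in> measurable M (count_space UNIV)"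
  by (intro measurable_sum_nat trials_measurable) (auto intro: finite_subset)

lemma sets_trials_sum: "A \<subseteq> {1..n} \<Longrightarrow> {\<omega> \<in> space M. P (\<Sum>j\<in>A. X j \<omega>)} \<in> sets M"
  using measurable_sets[OF trials_sum_measurable, of A "{i. P i}"]
  by (simp add: vimage_def Int_def conj_commute)

lemma history_events: "k \<le> n \<Longrightarrow> history M X k \<subseteq> sets M"
  unfolding history_def
  by (intro sets.sigma_sets_subset) (auto intro!: measurable_sets[OF trials_measurable])

text \<open>Provides the form in which independence of disjoint blocks applies. The sigma-algebra
  pulled back from the vector of the first \<open>k\<close> trials contains all generators of the
  history.\<close>

lemma history_eq_vimage:
  assumes "H \<in> history M X k" "k \<le> n"
  obtains E where "E \<in> sets (PiM {1..k} (\<lambda>_. count_space UNIV))"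
    "H = (\<lambda>\<omega>. restrict (\<lambda>i. X i \<omega>) {1..k}) -` E \<inter> space M"
proof -
  let ?N = "PiM {1..k} (\<lambda>_. count_space (UNIV :: nat set))"
  let ?Y = "\<lambda>\<omega>. restrict (\<lambda>i. X i \<omega>) {1..k}"
  have Y: "?Y \<in> space M \<rightarrow> space ?N" by (auto simp: space_PiM)
  let ?V = "vimage_algebra (space M) ?Y ?N"
  have "sigma_sets (space ?V) {X i -` B \<inter> space M | i B. i \<in> {1..k}} \<subseteq> sets ?V"
  proof (rule sets.sigma_sets_subset)
    show "{X i -` B \<inter> space M | i B. i \<in> {1..k}} \<subseteq> sets ?V"
    proof clarify
      fix i B assume i: "i \<in> {1..k}"
      have "(\<lambda>f. f i) -` B \<inter> space ?N \<in> sets ?N"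
        using i by (intro measurable_sets[OF measurable_component_singleton]) auto
      moreover have "X i -` B \<inter> space M = ?Y -` ((\<lambda>f. f i) -` B \<inter> space ?N) \<inter> space M"
        using i Y by (auto simp: space_PiM)
      ultimately show "X i -` B \<inter> space M \<in> sets ?V"
        unfolding sets_vimage_algebra2[OF Y] by blast
    qed
  qed
  then have "history M X k \<subseteq> sets ?V" by (simp only: history_def space_vimage_algebra)
  with assms that show ?thesis unfolding sets_vimage_algebra2[OF Y] by blast
qed

lemma prob_restrict_indep:
  assumes "A \<subseteq> {1..n}" "B \<subseteq> {1..n}" "A \<inter> B = {}"
    and "E \<in> sets (PiM A (\<lambda>_. count_space UNIV))" "F \<in> sets (PiM B (\<lambda>_. count_space UNIV))"
  shows "prob (((\<lambda>\<omega>. restrict (\<lambda>i. X i \<omega>) A) -` E \<inter> space M) \<inter> ((\<lambda>\<omega>. restrict (\<lambda>i. X i \<omega>) B) -` F \<inter> space M))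
    = prob ((\<lambda>\<omega>. restrict (\<lambda>i. X i \<omega>) A) -` E \<inter> space M) * prob ((\<lambda>\<omega>. restrict (\<lambda>i. X i \<omega>) B) -` F \<inter> space M)"
proof -
  have "indep_vars (\<lambda>_. count_space UNIV) X {1..n}" using bern by (simp add: bernoulli_trials_def)
  then have "indep_var (PiM A (\<lambda>_. count_space UNIV)) (\<lambda>\<omega>. restrict (\<lambda>i. X i \<omega>) A)
      (PiM B (\<lambda>_. count_space UNIV)) (\<lambda>\<omega>. restrict (\<lambda>i. X i \<omega>) B)"
    using assms by (intro indep_var_restrict) auto
  from indep_varD[OF this assms(4,5)] show ?thesis
    by (simp add: vimage_def Int_def conj_ac)
qed

lemma restrict_sum_event:
  assumes "finite B"
  shows "{f \<in> space (PiM B (\<lambda>_. count_space (UNIV :: nat set))). Q (\<Sum>j\<in>B. f j)}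
      \<in> sets (PiM B (\<lambda>_. count_space UNIV))"
    "(\<lambda>\<omega>. restrict (\<lambda>i. X i \<omega>) B) -`
      {f \<in> space (PiM B (\<lambda>_. count_space (UNIV :: nat set))). Q (\<Sum>j\<in>B. f j)} \<inter> space M
      = {\<omega> \<in> space M. Q (\<Sum>j\<in>B. X j \<omega>)}"
proof -
  let ?N = "PiM B (\<lambda>_. count_space (UNIV :: nat set))"
  have *: "(\<lambda>f. \<Sum>j\<in>B. f j) \<in> measurable ?N (count_space UNIV)"
    using assms by (intro measurable_sum_nat measurable_component_singleton)
  show "{f \<in> space ?N. Q (\<Sum>j\<in>B. f j)} \<in> sets ?N"
    using measurable_sets[OF *, of "{i. Q i}"]
    by (simp add: vimage_def Int_def conj_commute)
qed (auto simp: space_PiM)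

text \<open>Conditioning on one trial, viewed as the block \<open>{x}\<close>, reproduces the
  recursion \<open>poisson_binomial_insert\<close>.\<close>

lemma prob_sum_eq_poisson_binomial:
  assumes "A \<subseteq> {1..n}"
  shows "prob {\<omega> \<in> space M. int (\<Sum>j\<in>A. X j \<omega>) = i} = poisson_binomial p A i"
proof -
  have "finite A" using assms by (rule finite_subset) simp
  then show ?thesis using assms
  proof (induction A arbitrary: i)
    case empty
    then show ?case by (cases "i = 0") (auto simp: prob_space)
  next
    case (insert x A)
    have x: "x \<in> {1..n}" and A: "A \<subseteq> {1..n}" using insert.prems by auto
    have indep: "prob ({\<omega> \<in> space M. X x \<omega> = a} \<inter> {\<omega> \<in> space M. int (\<Sum>j\<in>A. X j \<omega>) = i})
       = prob {\<omega> \<in> space M. X x \<omega> = a} * poisson_binomial p A i" for a i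
      using prob_restrict_indep[OF _ A _ restrict_sum_event(1)[of "{x}" "\<lambda>y. y = a"]
          restrict_sum_event(1)[OF insert.hyps(1), of "\<lambda>y. int y = i"]] x insert.hyps
      unfolding restrict_sum_event(2)[OF insert.hyps(1), of "\<lambda>y. int y = i"]
        restrict_sum_event(2)[of "{x}" "\<lambda>y. y = a", OF finite.insertI[OF finite.emptyI]] insert.IH[OF A]
      by simp
    have events: "{\<omega> \<in> space M. X x \<omega> = a} \<in> sets M"
      "{\<omega> \<in> space M. int (\<Sum>j\<in>A. X j \<omega>) = i} \<in> sets M" for a i
      using sets_trials_sum[of "{x}" "\<lambda>y. y = a"] sets_trials_sum[OF A, of "\<lambda>y. int y = i"] x by auto
    have "prob {\<omega> \<in> space M. X x \<omega> = 0} = prob (space M - {\<omega> \<in> space M. X x \<omega> = 1})"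
      using trials_values[OF x] by (intro arg_cong[where f = prob]) auto
    also have "\<dots> = 1 - p x" using trials_prob[OF x] events by (subst prob_compl) auto
    finally have q: "prob {\<omega> \<in> space M. X x \<omega> = 0} = 1 - p x" .
    have "{\<omega> \<in> space M. int (\<Sum>j\<in>insert x A. X j \<omega>) = i}
      = ({\<omega> \<in> space M. X x \<omega> = 1} \<inter> {\<omega> \<in> space M. int (\<Sum>j\<in>A. X j \<omega>) = i - 1})
        \<union> ({\<omega> \<in> space M. X x \<omega> = 0} \<inter> {\<omega> \<in> space M. int (\<Sum>j\<in>A. X j \<omega>) = i})" (is "_ = ?U \<union> ?V")
      using insert.hyps by (auto dest: trials_values[OF x])
    moreover have "prob (?U \<union> ?V) = prob ?U + prob ?V"
      by (intro finite_measure_Union sets.Int events) auto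
    ultimately show ?case
      by (simp only: indep trials_prob[OF x] q poisson_binomial_insert[OF insert.hyps])
  qed
qed

text \<open>The way independence enters the backward induction: the past up to \<open>k\<close> does
  not affect later sums.\<close>

lemma prob_history_sum:
  assumes H: "H \<in> history M X k" and "k \<le> n" and A: "A \<subseteq> {k+1..n}"
  shows "prob (H \<inter> {\<omega> \<in> space M. int (\<Sum>j\<in>A. X j \<omega>) = i}) = prob H * poisson_binomial p A i"
proof -
  from H \<open>k \<le> n\<close> obtain E where E: "E \<in> sets (PiM {1..k} (\<lambda>_. count_space UNIV))"
    "H = (\<lambda>\<omega>. restrict (\<lambda>i. X i \<omega>) {1..k}) -` E \<inter> space M"
    by (rule history_eq_vimage)
  have fin: "finite A" using A by (rule finite_subset) simp
  have sub: "{1..k} \<subseteq> {1..n}" "A \<subseteq> {1..n}" "{1..k} \<inter> A = {}" using A \<open>k \<le> n\<close> by force+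
  show ?thesis
    using prob_restrict_indep[OF sub E(1) restrict_sum_event(1)[OF fin, of "\<lambda>y. int y = i"]]
    unfolding restrict_sum_event(2)[OF fin, of "\<lambda>y. int y = i"] prob_sum_eq_poisson_binomial[OF sub(2)] E(2)[symmetric] .
qed

text \<open>Backward induction: any supersolution \<open>V\<close> of the optimality equation bounds all rules.\<close>
lemma win_prob_le:
  assumes \<tau>: "\<tau> \<in> stopping_rules M n X" and V0: "0 \<le> V (n + 1)"
    and V: "\<And>k. k \<in> {1..n} \<Longrightarrow> V (k + 1) \<le> V k \<and>
      p k * poisson_binomial p {k+1..n} (int m - 1) + (1 - p k) * V (k + 1) \<le> V k"
  shows "win_prob M n X m \<tau> \<le> V 1"
proof -
  define W where "W k = {\<omega> \<in> space M. \<exists>t\<ge>k. \<tau> \<omega> = enat t \<and> (\<Sum>j=t..n. X j \<omega>) = m}" for k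
  define S where "S k = {\<omega> \<in> space M. \<tau> \<omega> = enat k}" for k
  define R where "R k = {\<omega> \<in> space M. enat k \<le> \<tau> \<omega>}" for k
  have range: "\<tau> \<omega> = \<infinity> \<or> (\<exists>t\<in>{1..n}. \<tau> \<omega> = enat t)" if "\<omega> \<in> space M" for \<omega>
    using \<tau> that by (auto simp: stopping_rules_def)
  have S_hist: "S k \<in> history M X k" if "k \<in> {1..n}" for k
    using \<tau> that by (auto simp: stopping_rules_def S_def)
  have S_success: "X k \<omega> = 1" if "\<omega> \<in> S k" for k \<omega>
    using \<tau> that by (auto simp: stopping_rules_def S_def)
  \<comment> \<open>Not having stopped by time \<open>k\<close> is decided by the first
    \<open>k\<close> trials, hence independent of trial \<open>k + 1\<close>.\<close>
  have R_hist: "R (k + 1) \<in> history M X k" if "k \<le> n" for k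
  proof -
    interpret h: sigma_algebra "space M" "history M X k" by (rule sigma_algebra_history)
    have "R (k + 1) = space M - (\<Union>j\<in>{1..k}. S j)"
    proof (intro equalityI subsetI)
      fix \<omega> assume "\<omega> \<in> space M - (\<Union>j\<in>{1..k}. S j)"
      then show "\<omega> \<in> R (k + 1)" using range[of \<omega>] by (auto simp: R_def S_def)
    qed (auto simp: R_def S_def)
    moreover have "S j \<in> history M X k" if "j \<in> {1..k}" for j
      using S_hist[of j] history_mono[of j k] that \<open>k \<le> n\<close> by auto
    ultimately show ?thesis using h.Diff[OF h.top h.finite_UN[of "{1..k}" S]] by simp
  qed
  have S_sets: "S k \<in> sets M" if "k \<in> {1..n}" for k
    using S_hist[OF that] history_events[of k] that by auto
  have R_sets: "R (k + 1) \<in> sets M" if "k \<le> n" for k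
    using R_hist[OF that] history_events[of k] that by auto
  have W_split: "W k = (S k \<inter> {\<omega> \<in> space M. (\<Sum>j=k..n. X j \<omega>) = m}) \<union> W (k + 1)" for k
    unfolding W_def S_def by (auto simp: Suc_le_eq intro: le_neq_implies_less)
  have W_end: "W (n + 1) = {}"
    using range by (auto simp: W_def) (metis atLeastAtMost_iff enat.distinct(1) enat.inject not_less_eq_eq)
  \<comment> \<open>Given no stop before \<open>k\<close>, the rule wins with probability at most
    \<open>V k\<close>; multiplying by \<open>prob (R k)\<close> avoids conditioning on null
    events.\<close>
  have bound: "W k \<in> sets M \<and> prob (W k) \<le> V k * prob (R k)" if "k \<in> {1..n+1}" for k
  proof -
    from that have "k \<le> n + 1" by simp
    then show ?thesis using that
    proof (induction rule: inc_induct)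
      case base
      then show ?case using W_end V0 by simp
    next
      case (step k)
      have k: "k \<in> {1..n}" using step by auto
      have IH: "W (k + 1) \<in> sets M" "prob (W (k + 1)) \<le> V (k + 1) * prob (R (k + 1))"
        using step by auto
      let ?f = "poisson_binomial p {k+1..n} (int m - 1)"
      \<comment> \<open>The stop at \<open>k\<close> is itself a success, so the later trials must
        supply the other \<open>m - 1\<close>.\<close>
      have eq: "S k \<inter> {\<omega> \<in> space M. (\<Sum>j=k..n. X j \<omega>) = m}
        = S k \<inter> {\<omega> \<in> space M. int (\<Sum>j\<in>{k+1..n}. X j \<omega>) = int m - 1}"
        using k S_success[of _ k] by (auto simp: sum.atLeast_Suc_atMost simp del: of_nat_sum)
      have "prob (S k \<inter> {\<omega> \<in> space M. (\<Sum>j=k..n. X j \<omega>) = m}) = prob (S k) * ?f"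
        unfolding eq using S_hist[OF k] k by (intro prob_history_sum) auto
      moreover have Wk: "S k \<inter> {\<omega> \<in> space M. (\<Sum>j=k..n. X j \<omega>) = m} \<in> sets M"
        using S_sets[OF k] k by (intro sets.Int sets_trials_sum) auto
      moreover have "prob (W k) \<le> prob (S k \<inter> {\<omega> \<in> space M. (\<Sum>j=k..n. X j \<omega>) = m}) + prob (W (k + 1))"
        unfolding W_split[of k] using Wk IH(1) by (intro measure_Un_le) auto
      ultimately have le: "prob (W k) \<le> prob (S k) * ?f + V (k + 1) * prob (R (k + 1))"
        using IH by simp
      have R_k: "R k \<in> history M X (k - 1)" "R k \<in> sets M"
        using R_hist[of "k - 1"] R_sets[of "k - 1"] k by auto
      have "enat k \<le> \<tau> \<omega> \<longleftrightarrow> \<tau> \<omega> = enat k \<or> enat (k + 1) \<le> \<tau> \<omega>" for \<omega>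
        by (cases "\<tau> \<omega>") auto
      then have "R k = S k \<union> R (k + 1)"
        unfolding R_def S_def by blast
      moreover have "S k \<inter> R (k + 1) = {}" by (auto simp: R_def S_def)
      ultimately have PR: "prob (R k) = prob (S k) + prob (R (k + 1))"
        using S_sets[OF k] R_sets[of k] k by (simp add: finite_measure_Union)
      \<comment> \<open>Stopping at \<open>k\<close> forces a success there, while
        \<open>R k\<close> depends on the first \<open>k - 1\<close> trials only.\<close>
      have "S k \<subseteq> R k \<inter> {\<omega> \<in> space M. int (\<Sum>j\<in>{k}. X j \<omega>) = 1}"
        using S_success by (auto simp: R_def S_def)
      then have "prob (S k) \<le> prob (R k \<inter> {\<omega> \<in> space M. int (\<Sum>j\<in>{k}. X j \<omega>) = 1})"
        using R_k k by (intro finite_measure_mono sets.Int sets_trials_sum) auto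
      also have "\<dots> = prob (R k) * poisson_binomial p {k} 1"
        using R_k k by (intro prob_history_sum[where k = "k - 1"]) auto
      also have "poisson_binomial p {k} 1 = p k" using poisson_binomial_insert[of "{}" k p 1] by simp
      finally have PS: "prob (S k) \<le> prob (R k) * p k" .
      \<comment> \<open>The bound is affine in \<open>prob (S k)\<close>, which lies between 0 and
        \<open>prob (R k) * p k\<close>. The sign of \<open>?f - V (k + 1)\<close> selects the worse
        endpoint, and each endpoint matches one inequality assumed for \<open>V\<close>.\<close>
      have "prob (S k) * ?f + V (k + 1) * prob (R (k + 1))
        = V (k + 1) * prob (R k) + prob (S k) * (?f - V (k + 1))"
        by (simp add: PR algebra_simps)
      also have "\<dots> \<le> V k * prob (R k)"
      proof (cases "V (k + 1) \<le> ?f")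
        case True
        then have "prob (S k) * (?f - V (k + 1)) \<le> prob (R k) * p k * (?f - V (k + 1))"
          using PS by (intro mult_right_mono) auto
        then have "V (k + 1) * prob (R k) + prob (S k) * (?f - V (k + 1))
          \<le> (p k * ?f + (1 - p k) * V (k + 1)) * prob (R k)" by (simp add: algebra_simps)
        also have "\<dots> \<le> V k * prob (R k)" using V[OF k] by (intro mult_right_mono) auto
        finally show ?thesis .
      next
        case False
        then have "prob (S k) * (?f - V (k + 1)) \<le> 0" by (intro mult_nonneg_nonpos) auto
        moreover have "V (k + 1) * prob (R k) \<le> V k * prob (R k)"
          using V[OF k] by (intro mult_right_mono) auto
        ultimately show ?thesis by simp
      qed
      finally show ?case using le Wk IH(1) W_split[of k] by auto
    qed
  qed
  have "R 1 = space M" using range by (force simp: R_def one_enat_def[symmetric])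
  moreover have "win_prob M n X m \<tau> = prob (W 1)"
    unfolding win_prob_def W_def using range
    by (intro arg_cong[where f = prob]) fastforce
  ultimately show ?thesis using bound[of 1] by (simp add: prob_space)
qed

section \<open>Rules stopping at the first success from a given index\<close>

lemma first_success_from_stopping_rule:
  assumes "1 \<le> k"
  shows "first_success_from n X k \<in> stopping_rules M n X"
proof -
  let ?\<tau> = "first_success_from n X k"
  \<comment> \<open>Replaces \<open>LEAST\<close> by a condition on trials up to \<open>t\<close>
    only, which makes the stopping event part of the history at \<open>t\<close>.\<close>
  have eq: "?\<tau> \<omega> = enat t \<longleftrightarrow> t \<in> {k..n} \<and> X t \<omega> = 1 \<and> (\<forall>j\<in>{k..<t}. X j \<omega> \<noteq> 1)" for \<omega> t
  proof
    assume L: "?\<tau> \<omega> = enat t"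
    then have ex: "\<exists>j. j \<in> {k..n} \<and> X j \<omega> = 1" and t: "t = (LEAST j. j \<in> {k..n} \<and> X j \<omega> = 1)"
      by (auto simp: first_success_from_def split: if_splits)
    from LeastI_ex[OF ex] t have 1: "t \<in> {k..n} \<and> X t \<omega> = 1" by simp
    moreover have "X j \<omega> \<noteq> 1" if "j \<in> {k..<t}" for j
      using not_less_Least[of j "\<lambda>j. j \<in> {k..n} \<and> X j \<omega> = 1"] that 1 unfolding t[symmetric] by auto
    ultimately show "t \<in> {k..n} \<and> X t \<omega> = 1 \<and> (\<forall>j\<in>{k..<t}. X j \<omega> \<noteq> 1)" by blast
  next
    assume R: "t \<in> {k..n} \<and> X t \<omega> = 1 \<and> (\<forall>j\<in>{k..<t}. X j \<omega> \<noteq> 1)"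
    have "(LEAST j. j \<in> {k..n} \<and> X j \<omega> = 1) = t"
    proof (rule Least_equality)
      fix j assume "j \<in> {k..n} \<and> X j \<omega> = 1"
      then show "t \<le> j" using R by (cases "j < t") auto
    qed (use R in simp)
    moreover have "\<exists>j\<in>{k..n}. X j \<omega> = 1" using R by blast
    ultimately show "?\<tau> \<omega> = enat t" by (simp only: first_success_from_def if_True)
  qed
  have "{\<omega> \<in> space M. ?\<tau> \<omega> = enat t} \<in> history M X t" if t: "t \<in> {1..n}" for t
  proof -
    interpret h: sigma_algebra "space M" "history M X t" by (rule sigma_algebra_history)
    show ?thesis
    proof (cases "k \<le> t")
      case True
      have "{\<omega> \<in> space M. ?\<tau> \<omega> = enat t}
        = (X t -` {1} \<inter> space M) - (\<Union>j\<in>{k..<t}. X j -` {1} \<inter> space M)"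
        using True t by (auto simp: eq)
      also have "\<dots> \<in> history M X t"
        using t assms by (intro h.Diff h.finite_UN history_vimage) auto
      finally show ?thesis .
    qed (simp add: eq)
  qed
  moreover have "?\<tau> \<omega> \<in> insert \<infinity> (enat ` {1..n})" for \<omega>
  proof (cases "?\<tau> \<omega>")
    case (enat t)
    with eq[of \<omega> t] assms show ?thesis by auto
  qed simp
  ultimately show ?thesis by (auto simp: stopping_rules_def eq)
qed

text \<open>Trials skipped before the first success contribute 0 to the sum. Without any success the
  sum is 0, which is not \<open>m\<close> since \<open>1 \<le> m\<close>.\<close>

lemma win_prob_first_success_from:
  assumes "1 \<le> k" "1 \<le> m"
  shows "win_prob M n X m (first_success_from n X k) = poisson_binomial p {k..n} m"
proof -
  have "(\<exists>t. first_success_from n X k \<omega> = enat t \<and> (\<Sum>j=t..n. X j \<omega>) = m)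
    \<longleftrightarrow> int (\<Sum>j\<in>{k..n}. X j \<omega>) = int m" if \<omega>: "\<omega> \<in> space M" for \<omega>
  proof (cases "\<exists>j\<in>{k..n}. X j \<omega> = 1")
    case True
    define t where "t = (LEAST j. j \<in> {k..n} \<and> X j \<omega> = 1)"
    have t: "t \<in> {k..n}" unfolding t_def
      using LeastI_ex[of "\<lambda>j. j \<in> {k..n} \<and> X j \<omega> = 1"] True by blast
    have "X j \<omega> = 0" if "j \<in> {k..n} - {t..n}" for j
    proof -
      have "j < t" using that by auto
      then have "X j \<omega> \<noteq> 1" using not_less_Least[of j "\<lambda>j. j \<in> {k..n} \<and> X j \<omega> = 1"] that
        by (auto simp: t_def)
      then show ?thesis using trials_values[of j \<omega>] that \<omega> assms by auto
    qed
    then have "(\<Sum>j=k..n. X j \<omega>) = (\<Sum>j=t..n. X j \<omega>)"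
      using t by (intro sum.mono_neutral_right) auto
    moreover have "first_success_from n X k \<omega> = enat t"
      using True by (simp add: first_success_from_def t_def)
    ultimately show ?thesis by (simp del: of_nat_sum)
  next
    case False
    then have "X j \<omega> = 0" if "j \<in> {k..n}" for j
      using trials_values[of j \<omega>] that \<omega> assms by auto
    then have "(\<Sum>j=k..n. X j \<omega>) = 0" by simp
    with False assms show ?thesis by (simp add: first_success_from_def)
  qed
  then have "win_prob M n X m (first_success_from n X k)
    = prob {\<omega> \<in> space M. int (\<Sum>j\<in>{k..n}. X j \<omega>) = int m}"
    unfolding win_prob_def by (intro arg_cong[where f = prob]) auto
  then show ?thesis using prob_sum_eq_poisson_binomial[of "{k..n}" "int m"] assms by simp
qed

end

section \<open>The threshold rule\<close>

text \<open>The lower bound on the tail sum needs \<open>2 \<le> k\<close>, since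
  \<open>k = 1\<close> may be the default value. The upper bound beyond \<open>k\<close> comes from
  maximality.\<close>

lemma threshold_index_props:
  assumes "1 \<le> m" "m \<le> n - 1"
    and p: "\<And>j. j \<in> {2..n} \<Longrightarrow> p j < 1"
  defines "k \<equiv> threshold_index p m n"
  shows "1 \<le> k" "k \<le> n - m" "2 \<le> k \<Longrightarrow> real m \<le> (\<Sum>j=k..n. p j)" "(\<Sum>j=k+1..n. p j) < real m"
proof -
  define I where "I = {i \<in> {1..n - m}. (\<Sum>j=i..n. p j) \<ge> real m}"
  have k: "k = Max (insert 1 I)" by (simp add: k_def threshold_index_def I_def)
  have fin: "finite (insert 1 I)" by (simp add: I_def)
  have mem: "k \<in> insert 1 I" unfolding k using fin by (intro Max_in) auto
  show "1 \<le> k" "k \<le> n - m" "2 \<le> k \<Longrightarrow> real m \<le> (\<Sum>j=k..n. p j)"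
    using mem assms(1,2) by (auto simp: I_def)
  show "(\<Sum>j=k+1..n. p j) < real m"
  proof (cases "k + 1 \<le> n - m")
    case True
    have "k + 1 \<notin> I"
      using Max_ge[OF fin, of "k + 1"] unfolding k[symmetric] by auto
    with True show ?thesis by (auto simp: I_def)
  next
    \<comment> \<open>Here \<open>k = n - m\<close>: exactly \<open>m\<close> trials remain, all
      with success probability below 1.\<close>
    case False
    with \<open>k \<le> n - m\<close> \<open>1 \<le> k\<close> assms(1,2) have c: "card {k+1..n} = m" "{k+1..n} \<noteq> {}" by auto
    have "(\<Sum>j=k+1..n. p j) < (\<Sum>j=k+1..n. 1)"
      using p c(2) \<open>1 \<le> k\<close> by (intro sum_strict_mono) auto
    then show ?thesis using c(1) by simp
  qed
qed

lemma bdd_above_win_prob: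
  assumes "prob_space M" shows "bdd_above (win_prob M n X m ` \<S>)"
  unfolding win_prob_def using prob_space.prob_le_1[OF assms] by (intro bdd_aboveI2) blast

text \<open>Serves both claims of the theorem; the bound \<open>p j < 1\<close> starts at index 2 so
  that \<open>p 1 = 1\<close> is covered.\<close>

lemma threshold_eps_optimal:
  assumes bern: "bernoulli_trials M n X p" and m: "1 \<le> m" "m \<le> n - 1"
    and p: "\<And>j. j \<in> {1..n} \<Longrightarrow> 0 < p j" "\<And>j. j \<in> {2..n} \<Longrightarrow> p j < 1"
  defines "k \<equiv> threshold_index p m n"
  assumes max: "\<And>j. j \<in> {k+1..n} \<Longrightarrow> p j \<le> p (k + 1)"
  shows "eps_optimal M n X m (p k * p (k + 1)) (threshold_rule p m n X)"
proof -
  interpret prob_space M using bern by (simp add: bernoulli_trials_def)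
  have p1: "0 < p j \<and> p j \<le> 1" if "j \<in> {1..n}" for j
    using p that prob_bounds[OF bern that] by auto
  note k = threshold_index_props[of m n p, OF m p(2), folded k_def]
  have k1: "1 \<le> k" "k + 1 \<le> n" using k m by auto
  define f where "f j i = poisson_binomial p {j..n} i" for j i
  have f_bounds: "0 \<le> f j i" "f j i \<le> 1" if "1 \<le> j" for j i
    using poisson_binomial_bounds[of "{j..n}" p i] p1 that by (auto simp: f_def less_imp_le)
  have f_rec: "f j i = p j * f (j + 1) (i - 1) + (1 - p j) * f (j + 1) i" if "j \<le> n" for j i
  proof -
    have "{j..n} = insert j {j+1..n}" using that by auto
    then show ?thesis by (simp add: f_def poisson_binomial_insert)
  qed
  \<comment> \<open>Tail sums only grow as \<open>j\<close> decreases from \<open>k\<close>, so the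
    mean stays at least \<open>m\<close>.\<close>
  have ascent: "f j (int m - 1) \<le> f j m" if "2 \<le> j" "j \<le> k" for j
  proof -
    have "real m \<le> (\<Sum>i=k..n. p i)" using k(3) that by simp
    also have "\<dots> \<le> (\<Sum>i=j..n. p i)"
      using that p1 by (intro sum_mono2) (auto simp: less_imp_le)
    finally show ?thesis unfolding f_def using p1 that by (intro poisson_binomial_ascent) auto
  qed
  \<comment> \<open>From \<open>k + 2\<close> on, the tail omits \<open>p (k + 1)\<close>; the bound
    \<open>m\<close> on the tail from \<open>k + 1\<close> thus leaves exactly the slack
    \<open>P = p (k + 1)\<close>, the largest remaining probability.\<close>
  have descent: "f j m \<le> f j (int m - 1)" if "k + 2 \<le> j" for j
  proof -
    have "(\<Sum>i=j..n. p i) + p (k + 1) \<le> (\<Sum>i=k+2..n. p i) + p (k + 1)"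
      using that p1 k1 by (intro add_right_mono sum_mono2) (auto simp: less_imp_le)
    also have "\<dots> = (\<Sum>i=k+1..n. p i)" using k1 by (simp add: sum.atLeast_Suc_atMost)
    finally have mean: "(\<Sum>i=j..n. p i) + p (k + 1) \<le> real m" using k(4) by simp
    show ?thesis unfolding f_def
      using that k1 m p p1[of "k + 1"] p1 max mean
      by (intro poisson_binomial_descent[where P = "p (k + 1)"]) (auto simp: less_imp_le)
  qed
  have increasing: "f j m \<le> f (j + 1) m" if "1 \<le> j" "j + 1 \<le> k" for j
  proof -
    have "j \<in> {1..n}" using that k1 by simp
    then have "p j * f (j + 1) (int m - 1) + (1 - p j) * f (j + 1) m
      \<le> p j * f (j + 1) m + (1 - p j) * f (j + 1) m"
      using ascent[of "j + 1"] that p by (intro add_right_mono mult_left_mono) (auto simp: less_imp_le)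
    then show ?thesis using f_rec[of j m] that k1 by (simp add: algebra_simps)
  qed
  \<comment> \<open>At \<open>k\<close> itself neither criterion settles the comparison, hence the
    maximum.\<close>
  define W where "W = max (f k m) (f (k + 1) m)"
  have le_W: "f j m \<le> W" if "1 \<le> j" "j \<le> k" for j
    using that(2,1)
  proof (induction rule: inc_induct)
    case base then show ?case by (simp add: W_def)
  next
    case (step j) then show ?case using increasing[of j] by simp
  qed
  \<comment> \<open>Continuing is optimal before \<open>k\<close> and stopping is optimal after \<open>k + 1\<close>, so \<open>V\<close> dominates
    the value function.\<close>
  define V where "V j = (if j \<le> k then W else f j m)" for j
  have "win_prob M n X m \<tau> \<le> V 1" if "\<tau> \<in> stopping_rules M n X" for \<tau>
    using bern that
  proof (rule win_prob_le)
    show "0 \<le> V (n + 1)" using k1 f_bounds by (simp add: V_def)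
    fix j assume j: "j \<in> {1..n}"
    have pj: "0 \<le> p j" "0 \<le> 1 - p j" using p1[OF j] by auto
    consider "j < k" | "j = k" | "k < j" by linarith
    then show "V (j + 1) \<le> V j \<and> p j * poisson_binomial p {j+1..n} (int m - 1) + (1 - p j) * V (j + 1) \<le> V j"
      unfolding f_def[symmetric]
    proof cases
      case 1
      have "f (j + 1) (int m - 1) \<le> W"
        using ascent[of "j + 1"] le_W[of "j + 1"] j 1 by simp
      then have "p j * f (j + 1) (int m - 1) \<le> p j * W" using pj by (intro mult_left_mono)
      with 1 show "V (j + 1) \<le> V j \<and> p j * f (j + 1) (int m - 1) + (1 - p j) * V (j + 1) \<le> V j"
        by (simp add: V_def algebra_simps)
    next
      \<comment> \<open>By \<open>f_rec\<close>, stopping on a success at \<open>k\<close> yields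
        \<open>f k m\<close>, and skipping \<open>k\<close> yields \<open>f (k + 1) m\<close>: the
        two entries of \<open>W\<close>.\<close>
      case 2
      with f_rec[of j m] j show "V (j + 1) \<le> V j \<and> p j * f (j + 1) (int m - 1) + (1 - p j) * V (j + 1) \<le> V j"
        by (simp add: V_def W_def)
    next
      case 3
      have "p j * f (j + 1) m \<le> p j * f (j + 1) (int m - 1)"
        using descent[of "j + 1"] 3 pj by (intro mult_left_mono) auto
      with 3 f_rec[of j m] j show "V (j + 1) \<le> V j \<and> p j * f (j + 1) (int m - 1) + (1 - p j) * V (j + 1) \<le> V j"
        by (simp add: V_def algebra_simps)
    qed
  qed
  moreover have "V 1 = W" using k1 by (simp add: V_def)
  moreover have rule: "threshold_rule p m n X \<in> stopping_rules M n X"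
    unfolding threshold_rule_def k_def[symmetric]
    using first_success_from_stopping_rule[OF bern k(1)] .
  ultimately have opt: "optimal_win_prob M n X m \<le> W"
    unfolding optimal_win_prob_def by (intro cSUP_least) auto
  have "f (k + 1) m - f k m = p k * (f (k + 1) m - f (k + 1) (int m - 1))"
    using f_rec[of k m] k1 by (simp add: algebra_simps)
  also have "\<dots> \<le> p k * p (k + 1)"
  proof (rule mult_left_mono)
    \<comment> \<open>Conditioning on trial \<open>k + 1\<close> gains the second factor: the first
      difference is at most 1 and the second is nonpositive by descent at
      \<open>k + 2\<close>.\<close>
    have "f (k + 1) m - f (k + 1) (int m - 1)
      = p (k + 1) * (f (k + 2) (int m - 1) - f (k + 2) (int m - 2))
        + (1 - p (k + 1)) * (f (k + 2) m - f (k + 2) (int m - 1))"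
      using f_rec[of "k + 1" m] f_rec[of "k + 1" "int m - 1"] k1 by (simp add: algebra_simps)
    also have "\<dots> \<le> p (k + 1) * 1 + 0"
    proof (rule add_mono)
      show "p (k + 1) * (f (k + 2) (int m - 1) - f (k + 2) (int m - 2)) \<le> p (k + 1) * 1"
        using p1[of "k + 1"] k1 f_bounds[of "k + 2" "int m - 1"] f_bounds[of "k + 2" "int m - 2"]
        by (intro mult_left_mono) auto
      show "(1 - p (k + 1)) * (f (k + 2) m - f (k + 2) (int m - 1)) \<le> 0"
        using p1[of "k + 1"] k1 descent[of "k + 2"] by (intro mult_nonneg_nonpos) auto
    qed
    finally show "f (k + 1) m - f (k + 1) (int m - 1) \<le> p (k + 1)" by simp
    show "0 \<le> p k" using p1[of k] k1 by simp
  qed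
  finally have "f (k + 1) m - f k m \<le> p k * p (k + 1)" .
  moreover have "0 \<le> p k * p (k + 1)" using p1[of k] p1[of "k + 1"] k1 by simp
  ultimately have "W - p k * p (k + 1) \<le> f k m" by (simp add: W_def)
  moreover have "win_prob M n X m (threshold_rule p m n X) = f k m"
    unfolding threshold_rule_def k_def[symmetric] f_def
    using win_prob_first_success_from[OF bern k(1) m(1)] .
  ultimately show ?thesis using opt rule by (simp add: eps_optimal_def)
qed

section \<open>Asymptotics for the Karamata--Stirling profile\<close>

text \<open>Each summand after the first dominates a telescoping logarithm through
  \<open>ln (1 + x) \<le> x\<close>; the first is only bounded below by 0.\<close>

lemma karamata_stirling_tail:
  assumes "0 < \<theta>" "1 \<le> i" "i \<le> n"
  shows "\<theta> * ln ((\<theta> + n) / (\<theta> + i)) \<le> (\<Sum>k=i..n. karamata_stirling \<theta> k)"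
proof -
  have "\<theta> * ln ((\<theta> + (i + d)) / (\<theta> + i)) \<le> (\<Sum>k=i..i+d. karamata_stirling \<theta> k)" for d
  proof (induction d)
    case 0
    then show ?case using assms by (simp add: karamata_stirling_def)
  next
    case (Suc d)
    have pos: "0 < \<theta> + i" "0 < \<theta> + (i + d)" using assms by auto
    have "(x + 1) / y = x / y * (1 + 1 / x)" if "0 < x" "0 < y" for x y :: real
      using that by (simp add: field_simps)
    from this[OF pos(2,1)]
    have "(\<theta> + (i + Suc d)) / (\<theta> + i) = (\<theta> + (i + d)) / (\<theta> + i) * (1 + 1 / (\<theta> + (i + d)))"
      by (simp add: add_ac)
    moreover have "0 < 1 + 1 / (\<theta> + (i + d))" using pos by (simp add: add_pos_pos)
    ultimately have "ln ((\<theta> + (i + Suc d)) / (\<theta> + i))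
      = ln ((\<theta> + (i + d)) / (\<theta> + i)) + ln (1 + 1 / (\<theta> + (i + d)))"
      using pos by (simp only: ln_mult_pos divide_pos_pos)
    also have "ln (1 + 1 / (\<theta> + (i + d))) \<le> 1 / (\<theta> + (i + d))"
      using pos by (intro ln_add_one_self_le_self) auto
    finally have "\<theta> * ln ((\<theta> + (i + Suc d)) / (\<theta> + i))
      \<le> \<theta> * (ln ((\<theta> + (i + d)) / (\<theta> + i)) + 1 / (\<theta> + (i + d)))"
      by (rule mult_left_mono) (use assms in auto)
    also have "\<dots> = \<theta> * ln ((\<theta> + (i + d)) / (\<theta> + i)) + \<theta> * (1 / (\<theta> + (i + d)))"
      by (rule distrib_left)
    also have "\<dots> \<le> (\<Sum>k=i..i+d. karamata_stirling \<theta> k) + karamata_stirling \<theta> (i + Suc d)"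
      using Suc.IH by (simp add: karamata_stirling_def add.assoc)
    finally show ?case by simp
  qed
  from this[of "n - i"] assms show ?thesis by simp
qed

text \<open>By the logarithmic bound an index \<open>i\<close> has tail sum at least
  \<open>m\<close> once \<open>(\<theta> + n) / (\<theta> + i)\<close> reaches
  \<open>1 / a = exp (m / \<theta>)\<close>; \<open>i\<close> near \<open>a * n / 2\<close> achieves
  this.\<close>

lemma karamata_stirling_threshold_index:
  assumes \<theta>: "0 < \<theta>"
  shows "\<exists>c>0. \<forall>\<^sub>F n in sequentially. c * real n \<le> real (threshold_index (karamata_stirling \<theta>) m n)"
proof -
  define a where "a = exp (- real m / \<theta>)"
  have a: "0 < a" "a \<le> 1" using \<theta> by (auto simp: a_def)
  have "\<forall>\<^sub>F n in sequentially. max (4 / a) (max (2 * \<theta> / a) (2 * real m + 2)) \<le> real n"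
    by real_asymp
  \<comment> \<open>The three bounds give, in order, \<open>1 \<le> i\<close> with
    \<open>a * n / 4 \<le> i\<close>, then \<open>\<theta> + i \<le> a * n\<close>, then
    \<open>i \<le> n - m\<close>.\<close>
  then have "\<forall>\<^sub>F n in sequentially. a / 4 * real n \<le> real (threshold_index (karamata_stirling \<theta>) m n)"
  proof eventually_elim
    case (elim n)
    then have n: "4 \<le> a * n" "2 * \<theta> \<le> a * n" "2 * real m + 2 \<le> n"
      using a by (auto simp: field_simps)
    define i where "i = nat \<lfloor>a * n / 2\<rfloor>"
    have i_le: "real i \<le> a * n / 2" and i_ge: "a * n / 2 < real i + 1"
    proof -
      have "real i = of_int \<lfloor>a * n / 2\<rfloor>" using n by (simp add: i_def)
      then show "real i \<le> a * n / 2" "a * n / 2 < real i + 1" by linarith+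
    qed
    have an: "a * n \<le> n" using a by (simp add: mult_left_le_one_le)
    have i: "1 \<le> i" "i \<le> n - m" "i \<le> n"
      using n an i_le i_ge by linarith+
    have "\<theta> + real i \<le> a * (\<theta> + real n)"
      using i_le n a \<theta> by (simp add: algebra_simps) (smt (verit) mult_pos_pos)
    then have "1 / a \<le> (\<theta> + real n) / (\<theta> + real i)"
      using a \<theta> by (simp add: field_simps)
    then have "ln (1 / a) \<le> ln ((\<theta> + real n) / (\<theta> + real i))"
      using a by (subst ln_le_cancel_iff) (auto intro: less_le_trans[of 0 "1 / a"])
    moreover have "ln (1 / a) = real m / \<theta>" using \<theta> by (simp add: a_def ln_div)
    ultimately have "real m \<le> \<theta> * ln ((\<theta> + real n) / (\<theta> + real i))"
      using \<theta> by (simp add: field_simps)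
    also have "\<dots> \<le> (\<Sum>k=i..n. karamata_stirling \<theta> k)"
      using \<theta> i by (intro karamata_stirling_tail) auto
    finally have "i \<le> threshold_index (karamata_stirling \<theta>) m n"
      unfolding threshold_index_def using i by (intro Max_ge) auto
    moreover have "a / 4 * real n \<le> real i" using i_ge n by simp
    ultimately show ?case by simp
  qed
  with a show ?thesis by (intro exI[of _ "a / 4"]) simp
qed

lemma karamata_stirling_error:
  fixes m :: nat
  assumes \<theta>: "0 < \<theta>"
  defines "k \<equiv> threshold_index (karamata_stirling \<theta>) m"
  shows "(\<lambda>n. karamata_stirling \<theta> (k n) * karamata_stirling \<theta> (k n + 1)) \<in> O(\<lambda>n. 1 / (real n)\<^sup>2)"
proof -
  from karamata_stirling_threshold_index[OF \<theta>, of m] obtain c where c: "0 < c"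
    and ev: "\<forall>\<^sub>F n in sequentially. c * real n \<le> real (k n)" unfolding k_def by blast
  have "\<forall>\<^sub>F n in sequentially. 2 / c \<le> real n" by real_asymp
  with ev have "\<forall>\<^sub>F n in sequentially. norm (karamata_stirling \<theta> (k n) * karamata_stirling \<theta> (k n + 1))
    \<le> (2 * \<theta> / c)\<^sup>2 * norm (1 / (real n)\<^sup>2)"
  proof eventually_elim
    case (elim n)
    then have n: "2 \<le> c * n" using c by (simp add: field_simps)
    then have n0: "0 < real n" using c by (cases n) auto
    have bound: "0 \<le> karamata_stirling \<theta> j \<and> karamata_stirling \<theta> j \<le> 2 * \<theta> / c / n" if "k n \<le> j" for j
    proof -
      \<comment> \<open>The condition \<open>2 \<le> c * n\<close> absorbs the \<open>- 1\<close> in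
        the denominator.\<close>
      have "c * n / 2 \<le> \<theta> + real j - 1" using elim that n \<theta> by linarith
      then have "\<theta> / (\<theta> + real j - 1) \<le> \<theta> / (c * n / 2)" using n \<theta> by (intro divide_left_mono) auto
      with \<open>c * n / 2 \<le> \<theta> + real j - 1\<close> show ?thesis using n \<theta> by (simp add: karamata_stirling_def field_simps)
    qed
    have "karamata_stirling \<theta> (k n) * karamata_stirling \<theta> (k n + 1) \<le> (2 * \<theta> / c / n) * (2 * \<theta> / c / n)"
      using bound[of "k n"] bound[of "k n + 1"] by (intro mult_mono) auto
    also have "\<dots> = (2 * \<theta> / c)\<^sup>2 * norm (1 / (real n)\<^sup>2)"
      by (simp add: power2_eq_square)
    finally show ?case using bound[of "k n"] bound[of "k n + 1"] by simp
  qed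
  then show ?thesis by (rule bigoI)
qed

theorem theorem7:
  fixes m :: nat
  assumes "1 \<le> m"
  shows
    "(\<forall>(M :: 'a measure) n X p.
        m \<le> n - 1 \<and> bernoulli_trials M n X p \<and> (\<forall>k\<in>{1..n}. 0 < p k \<and> p k < 1) \<and>
        p (threshold_index p m n) \<ge> p (threshold_index p m n + 1) \<and>
        p (threshold_index p m n + 1) = Max (p ` {threshold_index p m n + 1..n}) \<longrightarrow>
        (\<exists>\<epsilon>. 0 \<le> \<epsilon> \<and> \<epsilon> \<le> p (threshold_index p m n) * p (threshold_index p m n + 1) \<and>
             eps_optimal M n X m \<epsilon> (threshold_rule p m n X)))
     \<and>
     (\<forall>\<theta> (M :: nat \<Rightarrow> 'a measure) X p.
        \<theta> > 0 \<and> p = karamata_stirling \<theta> \<and> (\<forall>n. bernoulli_trials (M n) n (X n) p) \<longrightarrow>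
        (\<exists>\<epsilon> :: nat \<Rightarrow> real.
            (\<forall>n. m \<le> n - 1 \<longrightarrow>
               0 \<le> \<epsilon> n \<and> \<epsilon> n \<le> p (threshold_index p m n) * p (threshold_index p m n + 1) \<and>
               eps_optimal (M n) n (X n) m (\<epsilon> n) (threshold_rule p m n (X n))) \<and>
            \<epsilon> \<in> O(\<lambda>n. 1 / (real n)\<^sup>2)) \<and>
        asymptotically_optimal M X m (\<lambda>n. threshold_rule p m n (X n)))"
proof (intro conjI allI impI; elim conjE)
  fix M :: "'a measure" and n X p
  let ?k = "threshold_index p m n"
  assume *: "m \<le> n - 1" "bernoulli_trials M n X p" "\<forall>k\<in>{1..n}. 0 < p k \<and> p k < 1"
    "p (?k + 1) = Max (p ` {?k + 1..n})"
  have "p j \<le> p (?k + 1)" if "j \<in> {?k + 1..n}" for j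
    unfolding *(4) using that by (intro Max_ge) auto
  \<comment> \<open>The witness for \<open>\<epsilon>\<close> is the upper bound itself, here and in
    the second claim.\<close>
  then have "eps_optimal M n X m (p ?k * p (?k + 1)) (threshold_rule p m n X)"
    using * assms by (intro threshold_eps_optimal) auto
  moreover have "0 \<le> p ?k * p (?k + 1)"
  proof -
    have "1 \<le> ?k" "?k \<le> n - m" using threshold_index_props(1,2)[of m n p] * assms by auto
    then have "0 < p ?k" "0 < p (?k + 1)" using *(1,3) assms by auto
    then show ?thesis by simp
  qed
  ultimately show "\<exists>\<epsilon>. 0 \<le> \<epsilon> \<and> \<epsilon> \<le> p ?k * p (?k + 1) \<and> eps_optimal M n X m \<epsilon> (threshold_rule p m n X)"
    by blast
next
  fix \<theta> :: real and M :: "nat \<Rightarrow> 'a measure" and X p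
  assume \<theta>: "0 < \<theta>" and p: "p = karamata_stirling \<theta>" and bern: "\<forall>n. bernoulli_trials (M n) n (X n) p"
  define k where "k n = threshold_index p m n" for n
  define \<epsilon> where "\<epsilon> n = p (k n) * p (k n + 1)" for n
  have p_pos: "0 < p j" if "1 \<le> j" for j
    using \<theta> that by (simp add: p karamata_stirling_def)
  have p_antimono: "p j \<le> p i" if "1 \<le> i" "i \<le> j" for i j
    using \<theta> that unfolding p karamata_stirling_def by (intro divide_left_mono mult_pos_pos) auto
  \<comment> \<open>Index 1 is left out because this profile has \<open>p 1 = 1\<close>.\<close>
  have p_less_1: "p j < 1" if "2 \<le> j" for j
    using \<theta> that by (simp add: p karamata_stirling_def)
  have k1: "1 \<le> k n" for n
    unfolding k_def threshold_index_def by (intro Max_ge) auto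
  have eps: "eps_optimal (M n) n (X n) m (\<epsilon> n) (threshold_rule p m n (X n))" if "m \<le> n - 1" for n
    unfolding \<epsilon>_def k_def using assms that bern p_pos p_less_1 p_antimono k1[unfolded k_def]
    by (intro threshold_eps_optimal) auto
  have \<epsilon>_nonneg: "0 \<le> \<epsilon> n" for n
    using p_pos[of "k n"] p_pos[of "k n + 1"] k1[of n] by (simp add: \<epsilon>_def)
  have \<epsilon>_O: "\<epsilon> \<in> O(\<lambda>n. 1 / (real n)\<^sup>2)"
    using karamata_stirling_error[OF \<theta>, of m] unfolding \<epsilon>_def[abs_def] k_def p .
  show "\<exists>\<epsilon>. (\<forall>n. m \<le> n - 1 \<longrightarrow>
          0 \<le> \<epsilon> n \<and> \<epsilon> n \<le> p (threshold_index p m n) * p (threshold_index p m n + 1) \<and>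
          eps_optimal (M n) n (X n) m (\<epsilon> n) (threshold_rule p m n (X n))) \<and>
        \<epsilon> \<in> O(\<lambda>n. 1 / (real n)\<^sup>2)"
    using eps \<epsilon>_nonneg \<epsilon>_O by (intro exI[of _ \<epsilon>]) (simp add: \<epsilon>_def k_def)
  have rule: "threshold_rule p m n (X n) \<in> stopping_rules (M n) n (X n)" for n
    unfolding threshold_rule_def using bern k1[of n, unfolded k_def]
    by (intro first_success_from_stopping_rule[of _ _ _ p]) auto
  let ?gap = "\<lambda>n. optimal_win_prob (M n) n (X n) m - win_prob (M n) n (X n) m (threshold_rule p m n (X n))"
  have "?gap \<longlonglongrightarrow> 0"
  proof (rule tendsto_sandwich)
    \<comment> \<open>The lower bound on the gap holds for every \<open>n\<close>, as the rule
      always belongs to the class; the upper bound \<open>\<epsilon> n\<close> holds from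
      \<open>n = m + 1\<close> on.\<close>
    have "win_prob (M n) n (X n) m (threshold_rule p m n (X n)) \<le> optimal_win_prob (M n) n (X n) m" for n
      unfolding optimal_win_prob_def using rule[of n] bern
      by (intro cSUP_upper bdd_above_win_prob) (auto simp: bernoulli_trials_def)
    then show "\<forall>\<^sub>F n in sequentially. 0 \<le> ?gap n" by simp
    have "?gap n \<le> \<epsilon> n" if "m + 1 \<le> n" for n
    proof -
      have "m \<le> n - 1" using that by simp
      from eps[OF this] show ?thesis by (simp add: eps_optimal_def)
    qed
    then show "\<forall>\<^sub>F n in sequentially. ?gap n \<le> \<epsilon> n"
      unfolding eventually_sequentially by blast
    have "(\<lambda>n. 1 / (real n)\<^sup>2) \<in> o(\<lambda>_. 1)" by real_asymp
    with \<epsilon>_O have "\<epsilon> \<in> o(\<lambda>_. 1)" by (rule landau_o.big_small_trans)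
    then show "\<epsilon> \<longlonglongrightarrow> 0" by (auto dest: smalloD_tendsto)
  qed simp
  with rule show "asymptotically_optimal M X m (\<lambda>n. threshold_rule p m n (X n))"
    by (simp add: asymptotically_optimal_def)
qed

end
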